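(* Let $a\neq0$ be a complex number. For $m,n\in\mathbb{N}$ with $m\le n$, \[ \binom{n-1}{m-1}B_{n-m}^{(-m+1)}(1)=(n-1)!\sum_{k=0}^{n-m}\frac{\binom{-an}{n-k-m}\binom{k+m-1}{k}}{(k+m-1)!}B_k^{(k-n+1)}(an+1). \]
   Context: For real $r$ (including nonpositive $r$), the Bernoulli polynomials of order $r$ are defined by $\left(\frac{t}{e^t-1}\right)^re^{xt}=\sum_{n\ge0}B_n^{(r)}(x)\frac{t^n}{n!}$ as formal power series. For complex $z$ and integer $j\ge0$, $\binom{z}{j}=z(z-1)\cdots(z-j+1)/j!$. *)

theory Defs
  imports Complex_Main "HOL-Computational_Algebra.Formal_Power_Series"
begin

(* The power f^r of a power series f with constant coefficient 1 is read as the
   binomial series (1 + u)^r composed with u = f - 1.  Composition is meaningful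
   only if u has zero constant coefficient, which bernoulli_base_nth_0 verifies
   for f = t / (e^t - 1). *)

definition bernoulli_base :: "complex fps" where
  "bernoulli_base = fps_X / (fps_exp 1 - 1)"

lemma bernoulli_base_mult: "bernoulli_base * (fps_exp 1 - 1) = fps_X"
proof -
  have nz: "fps_nth (fps_exp 1 - 1 :: complex fps) 1 \<noteq> 0"
    by simp
  hence "(fps_exp 1 - 1 :: complex fps) \<noteq> 0"
    by (metis fps_zero_nth)
  moreover have "subdegree (fps_exp 1 - 1 :: complex fps) \<le> subdegree (fps_X :: complex fps)"
    using subdegree_leI[OF nz] by simp
  ultimately have "(fps_exp 1 - 1 :: complex fps) dvd fps_X"
    by (simp add: fps_dvd_iff)
  thus ?thesis
    unfolding bernoulli_base_def by (rule dvd_div_mult_self)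
qed

lemma bernoulli_base_nth_0: "fps_nth bernoulli_base 0 = 1"
  using arg_cong[OF bernoulli_base_mult, of "\<lambda>f. fps_nth f 1"]
  by (simp add: fps_mult_nth)

definition bernoulli_poly :: "real \<Rightarrow> nat \<Rightarrow> complex \<Rightarrow> complex" where
  "bernoulli_poly r n x =
     fact n * fps_nth (fps_compose (fps_binomial (of_real r)) (bernoulli_base - 1) * fps_exp x) n"

end

theory Submission
  imports Defs
begin

text \<open>
  For a natural number \<open>N\<close>, \<open>B_k^{(-N)}(x)\<close> is \<open>k!\<close> times the coefficient of \<open>t^{N+k}\<close> in
  \<open>(e^t - 1)^N e^{xt}\<close>.  Hence, with \<open>u = e^t - 1\<close>, both sides are the same multiple of the
  coefficient of \<open>t^{n-1}\<close> in \<open>u^{m-1} e^t\<close>: on the right-hand side, write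
  \<open>e^t = e^{-ant} e^{(an+1)t}\<close> and expand \<open>e^{-ant} = (1 + u)^{-an}\<close> by the binomial series.
  The terms \<open>u^j\<close> with \<open>j > n - m\<close> do not contribute, since \<open>u\<close> has no constant term.
\<close>

text \<open>Since \<open>u\<close> has no constant term, \<open>u ^ j\<close> has no coefficient at
  \<open>i\<close> when \<open>j > i\<close>. So the sum for each coefficient \<open>i\<close> of
  the composition can be extended to the common bound \<open>N\<close>, and the two sums
  swap.\<close>

lemma fps_nth_compose_mult:
  fixes f u g :: "'a::idom fps"
  assumes "fps_nth u 0 = 0"
  shows "fps_nth (fps_compose f u * g) N = (\<Sum>j=0..N. fps_nth f j * fps_nth (u ^ j * g) N)"
proof -
  have "fps_nth (fps_compose f u) i = (\<Sum>j=0..N. fps_nth f j * fps_nth (u ^ j) i)" if "i \<le> N" for i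
    unfolding fps_compose_nth
    by (rule sum.mono_neutral_left) (use that startsby_zero_power_prefix[OF assms] in auto)
  then have "fps_nth (fps_compose f u * g) N =
      (\<Sum>i=0..N. \<Sum>j=0..N. fps_nth f j * (fps_nth (u ^ j) i * fps_nth g (N - i)))"
    by (simp add: fps_mult_nth sum_distrib_right mult.assoc)
  also have "\<dots> = (\<Sum>j=0..N. \<Sum>i=0..N. fps_nth f j * (fps_nth (u ^ j) i * fps_nth g (N - i)))"
    by (rule sum.swap)
  finally show ?thesis
    by (simp add: fps_mult_nth sum_distrib_left)
qed

text \<open>Substituting \<open>u = fps_exp 1 - 1\<close> in (1 + X) B' = c B turns 1 + X into e^t,
  which is also u'. By the chain rule the composition solves F' = c F with F(0) = 1.\<close>

lemma fps_binomial_compose_exp_minus_1: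
  fixes c :: "'a::field_char_0"
  shows "fps_compose (fps_binomial c) (fps_exp 1 - 1) = fps_exp c"
proof -
  define u :: "'a fps" where "u = fps_exp 1 - 1"
  have u0: "fps_nth u 0 = 0"
    by (simp add: u_def)
  have "(1 + fps_X) * fps_deriv (fps_binomial c) = fps_const c * fps_binomial c"
    by (simp add: fps_binomial_deriv fps_divide_unit inverse_mult_eq_1' mult.left_commute)
  then have "fps_compose ((1 + fps_X) * fps_deriv (fps_binomial c)) u
      = fps_compose (fps_const c * fps_binomial c) u"
    by simp
  then have "fps_exp 1 * fps_compose (fps_deriv (fps_binomial c)) u
      = fps_const c * fps_compose (fps_binomial c) u"
    using u0 by (simp add: fps_compose_mult_distrib fps_compose_add_distrib u_def)
  then have "fps_deriv (fps_compose (fps_binomial c) u) = fps_const c * fps_compose (fps_binomial c) u"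
    using u0 by (simp add: fps_compose_deriv u_def mult.commute)
  then show ?thesis
    by (simp add: fps_exp_unique_ODE u_def)
qed

lemma bernoulli_poly_neg_of_nat:
  "bernoulli_poly (- real N) k x = fact k * fps_nth ((fps_exp 1 - 1) ^ N * fps_exp x) (N + k)"
proof -
  define C where "C = fps_compose (fps_binomial (- of_nat N)) (bernoulli_base - 1)"
  have u0: "fps_nth (bernoulli_base - 1) 0 = 0"
    by (simp add: bernoulli_base_nth_0)
  \<comment> \<open>Composing this identity shows that \<open>C\<close> is the inverse of
    \<open>bernoulli_base ^ N\<close>, so multiplying \<open>C\<close> by \<open>fps_X ^ N\<close>
    leaves \<open>(fps_exp 1 - 1) ^ N\<close>.\<close>
  have "fps_binomial (of_nat N :: complex) * fps_binomial (- of_nat N) = 1"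
    by (simp flip: fps_binomial_add_mult)
  then have "(1 + fps_X) ^ N * fps_binomial (- of_nat N :: complex) = 1"
    by (simp add: fps_binomial_of_nat)
  then have "fps_compose ((1 + fps_X) ^ N * fps_binomial (- of_nat N)) (bernoulli_base - 1) = 1"
    by simp
  then have inv: "bernoulli_base ^ N * C = 1"
    using u0 by (simp add: C_def fps_compose_mult_distrib fps_compose_power[symmetric] fps_compose_add_distrib)
  have "fps_X ^ N * C = (fps_exp 1 - 1) ^ N * (bernoulli_base ^ N * C)"
    by (simp add: power_mult_distrib mult_ac flip: bernoulli_base_mult)
  then have "(fps_exp 1 - 1) ^ N * fps_exp x = fps_X ^ N * (C * fps_exp x)"
    by (simp add: inv mult.assoc)
  then have "fps_nth ((fps_exp 1 - 1) ^ N * fps_exp x) (N + k) = fps_nth (C * fps_exp x) k"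
    by (simp only: fps_X_power_mult_nth) simp
  then show ?thesis
    by (simp add: bernoulli_poly_def C_def)
qed

theorem theorem14:
  fixes a :: complex and m n :: nat
  assumes "a \<noteq> 0" and "1 \<le> m" and "m \<le> n"
  shows "of_nat ((n - 1) choose (m - 1)) * bernoulli_poly (- real m + 1) (n - m) 1 =
    fact (n - 1) *
      (\<Sum>k = 0..n - m.
         ((- a * of_nat n) gchoose (n - k - m)) * of_nat ((k + m - 1) choose k) / fact (k + m - 1)
         * bernoulli_poly (real k - real n + 1) k (a * of_nat n + 1))"
proof -
  obtain p where p: "m = Suc p"
    using assms(2) by (cases m) auto
  obtain d where n: "n = Suc (p + d)"
    using assms(3) p by (auto simp: le_iff_add)
  define c where "c = a * of_nat n"
  define u :: "complex fps" where "u = fps_exp 1 - 1"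
  define h where "h j = fps_nth (u ^ j * fps_exp (c + 1)) (p + d)" for j
  have u0: "fps_nth u 0 = 0"
    by (simp add: u_def)
  have lhs: "bernoulli_poly (- real m + 1) (n - m) 1 = fact d * fps_nth (u ^ p * fps_exp 1) (p + d)"
    using bernoulli_poly_neg_of_nat[of p d 1] by (simp add: p n u_def)
  have summand: "(- a * of_nat n gchoose (n - k - m)) * of_nat ((k + m - 1) choose k) / fact (k + m - 1)
         * bernoulli_poly (real k - real n + 1) k (a * of_nat n + 1)
       = (- c gchoose (d - k)) * h (p + (d - k)) / fact p" if "k \<le> d" for k
  proof -
    \<comment> \<open>The order k - n + 1 is -N for N = p + (d - k). Then N + k = p + d for every k,
      so all summands read off the same coefficient.\<close>
    have "bernoulli_poly (real k - real n + 1) k (c + 1) = fact k * h (p + (d - k))"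
      using bernoulli_poly_neg_of_nat[of "p + (d - k)" k "c + 1"] that
      by (simp add: h_def u_def n of_nat_diff algebra_simps)
    then show ?thesis
      \<comment> \<open>The factor k! binom(k+p, k) / (k+p)! collapses to 1/p!.\<close>
      using that by (simp add: c_def p n binomial_fact)
  qed
  have "fps_exp 1 = fps_exp (- c) * fps_exp (c + 1)"
    by (simp flip: fps_exp_add_mult)
  then have "u ^ p * fps_exp 1 = fps_compose (fps_X ^ p * fps_binomial (- c)) u * fps_exp (c + 1)"
    using u0 fps_binomial_compose_exp_minus_1[of "- c", folded u_def]
    by (simp add: fps_compose_mult_distrib fps_compose_power[symmetric] mult.assoc)
  then have "fps_nth (u ^ p * fps_exp 1) (p + d) =
      (\<Sum>j=0..p + d. fps_nth (fps_X ^ p * fps_binomial (- c)) j * h j)"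
    using u0 by (simp add: fps_nth_compose_mult h_def)
  \<comment> \<open>The factor \<open>fps_X ^ p\<close> removes the terms with j < p and shifts the
    binomial coefficients by p.\<close>
  also have "\<dots> = (\<Sum>j=p..p + d. (- c gchoose (j - p)) * h j)"
    by (rule sum.mono_neutral_cong_right) (auto simp: fps_X_power_mult_nth)
  also have "\<dots> = (\<Sum>j=0..d. (- c gchoose j) * h (p + j))"
    using sum.shift_bounds_cl_nat_ivl[of "\<lambda>j. (- c gchoose (j - p)) * h j" 0 p d]
    by (simp add: add.commute)
  also have "\<dots> = (\<Sum>k=0..d. (- c gchoose (d - k)) * h (p + (d - k)))"
    by (subst sum.atLeastAtMost_rev) simp
  finally have key: "fps_nth (u ^ p * fps_exp 1) (p + d) = \<dots>" .
  have "(\<Sum>k = 0..n - m.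
         ((- a * of_nat n) gchoose (n - k - m)) * of_nat ((k + m - 1) choose k) / fact (k + m - 1)
         * bernoulli_poly (real k - real n + 1) k (a * of_nat n + 1))
       = (\<Sum>k=0..d. (- c gchoose (d - k)) * h (p + (d - k)) / fact p)"
    by (rule sum.cong) (use summand in \<open>auto simp: n p\<close>)
  also have "\<dots> = fps_nth (u ^ p * fps_exp 1) (p + d) / fact p"
    by (simp add: key sum_divide_distrib)
  finally show ?thesis
    \<comment> \<open>The prefactors agree because binom(p+d, p) d! = (p+d)!/p!.\<close>
    by (simp only: lhs) (simp add: n p binomial_fact)
qed

end
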